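(* Let $\mathbf G(x,\mathbf y)\in\mathbb R[[x,\mathbf y]]^k$ have all coefficients non-negative and satisfy $\mathbf G(0,\mathbf 0)=\mathbf 0$. (a) Suppose $I-J_{\mathbf G}(0,\mathbf 0)$ is invertible with non-negative inverse, and set $\widehat{\mathbf G}(x,\mathbf y)=(I-J_{\mathbf G}(0,\mathbf 0))^{-1}\big(\mathbf G(x,\mathbf 0)+\mathbf H(x,\mathbf y)\big)$ where $\mathbf H(x,\mathbf y)=\mathbf G(x,\mathbf y)-\mathbf G(x,\mathbf 0)-J_{\mathbf G}(0,\mathbf 0)\mathbf y$. Then (i) the systems $\mathbf y=\widehat{\mathbf G}(x,\mathbf y)$ and $\mathbf y=\mathbf G(x,\mathbf y)$ have the same solutions; (ii) $\mathbf y=\widehat{\mathbf G}(x,\mathbf y)$ is an elementary system; (iii) $\mathbf T(x):=\lim_{n\to\infty}\widehat{\mathbf G}^{(n)}(x,\mathbf 0)$ is the unique solution in $\mathbb R[[x]]_0^k$ of $\mathbf y=\mathbf G(x,\mathbf y)$ as well as of $\mathbf y=\widehat{\mathbf G}(x,\mathbf y)$. (b) Suppose that every component of $\mathbf G^{(k)}(x,\mathbf 0)$ is a non-zero power series. Then the following are equivalent: (i) $I-J_{\mathbf G}(0,\mathbf 0)$ has a non-negative inverse; (ii) $\mathbf y=\mathbf G(x,\mathbf y)$ has a solution $\mathbf T(x)$ each of whose components is a power series with non-negative coefficients and zero constant term; (iii) $\Lambda(J_{\mathbf G}(0,\mathbf 0))<1$.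
   Context: $\mathbf y=(y_1,\dots,y_k)$; $J_{\mathbf G}$ is the Jacobian matrix of $\mathbf G$ with respect to $\mathbf y$; $\mathbb R[[x]]_0$ denotes real power series with zero constant term. A matrix is non-negative if all entries are $\ge0$. A system $\mathbf y=\mathbf F(x,\mathbf y)$ is elementary if all coefficients of $\mathbf F$ are non-negative, $\mathbf F(0,\mathbf 0)=\mathbf 0$ and $J_{\mathbf F}(0,\mathbf 0)=\mathbf 0$. $\mathbf F^{(0)}(x,\mathbf y)=\mathbf y$, $\mathbf F^{(n+1)}(x,\mathbf y)=\mathbf F(x,\mathbf F^{(n)}(x,\mathbf y))$; limits are $x$-adic (eventual agreement of each coefficient). For a non-negative square matrix $M$, $\Lambda(M)$ is its largest real eigenvalue (which exists and is $\ge0$ by Perron–Frobenius). *)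

theory Defs
  imports "HOL-Analysis.Analysis" "HOL-Library.Multiset"
begin

(* A monomial in commuting variables of type 'v is the multiset of its variables: the number of
   occurrences of a variable is its exponent, {#} is the monomial 1, sum is product of monomials
   and size is the total degree. *)
typedef 'v mfps = "UNIV :: ('v multiset \<Rightarrow> real) set"
  morphisms mcoeff Abs_mfps by simp

lemma mcoeff_Abs_mfps [simp]: "mcoeff (Abs_mfps c) d = c d"
  by (simp add: Abs_mfps_inverse)

lemma mfps_eqI: "(\<And>d. mcoeff f d = mcoeff g d) \<Longrightarrow> f = g"
  by (simp add: mcoeff_inject[symmetric] fun_eq_iff)

lemma finite_submultisets: "finite {a. a \<subseteq># (d :: 'v multiset)}"
proof (rule finite_subset)
  show "{a. a \<subseteq># d} \<subseteq> (\<Union>n\<in>{..size d}. multisets_of_size (set_mset d) n)"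
    by (auto simp: multisets_of_size_def size_mset_mono dest: mset_subset_eqD)
qed auto

lemma finite_splittings: "finite {(a, b). a + b = (d :: 'v multiset)}"
  by (rule finite_subset[OF _ finite_cartesian_product[OF finite_submultisets[of d] finite_submultisets[of d]]])
     auto

instantiation mfps :: (type) comm_ring_1
begin

definition zero_mfps_def: "0 = Abs_mfps (\<lambda>d. 0)"
definition one_mfps_def: "1 = Abs_mfps (\<lambda>d. if d = {#} then 1 else 0)"
definition plus_mfps_def: "f + g = Abs_mfps (\<lambda>d. mcoeff f d + mcoeff g d)"
definition minus_mfps_def: "f - g = Abs_mfps (\<lambda>d. mcoeff f d - mcoeff g d)"
definition uminus_mfps_def: "- f = Abs_mfps (\<lambda>d. - mcoeff f d)"
definition times_mfps_def:
  "f * g = Abs_mfps (\<lambda>d. \<Sum>(a, b) | a + b = d. mcoeff f a * mcoeff g b)"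

instance
proof
  fix f g h :: "'a mfps"
  show "f * g * h = f * (g * h)"
  proof (rule mfps_eqI)
    fix d :: "'a multiset"
    let ?t = "\<lambda>a b c. mcoeff f a * mcoeff g b * mcoeff h c"
    have "mcoeff (f * g * h) d
        = (\<Sum>(e, c) \<in> {(e, c). e + c = d}. \<Sum>(a, b) \<in> {(a, b). a + b = e}. ?t a b c)"
      by (simp add: times_mfps_def sum_distrib_right case_prod_unfold)
    also have "\<dots> = (\<Sum>(p, q) \<in> (SIGMA p:{(e, c). e + c = d}. {(a, b). a + b = fst p}).
                       ?t (fst q) (snd q) (snd p))"
      by (subst sum.Sigma[symmetric]) (auto simp: finite_splittings finite_splittings[unfolded case_prod_unfold] case_prod_unfold)
    also have "\<dots> = (\<Sum>(p, q) \<in> (SIGMA p:{(a, e). a + e = d}. {(b, c). b + c = snd p}).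
                       ?t (fst p) (fst q) (snd q))"
      by (rule sum.reindex_bij_witness[where
            i = "\<lambda>((a, e), (b, c)). ((a + b, c), (a, b))" and
            j = "\<lambda>((e, c), (a, b)). ((a, b + c), (b, c))"]) (auto simp: add.assoc)
    also have "\<dots> = (\<Sum>(a, e) \<in> {(a, e). a + e = d}. \<Sum>(b, c) \<in> {(b, c). b + c = e}. ?t a b c)"
      by (subst sum.Sigma[symmetric]) (auto simp: finite_splittings finite_splittings[unfolded case_prod_unfold] case_prod_unfold)
    also have "\<dots> = mcoeff (f * (g * h)) d"
      by (simp add: times_mfps_def sum_distrib_left case_prod_unfold mult.assoc)
    finally show "mcoeff (f * g * h) d = mcoeff (f * (g * h)) d" .
  qed
  show "f * g = g * f"
  proof (rule mfps_eqI)
    fix d :: "'a multiset"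
    have "(\<Sum>(a, b) | a + b = d. mcoeff f a * mcoeff g b)
        = (\<Sum>(a, b) | a + b = d. mcoeff g a * mcoeff f b)"
      by (rule sum.reindex_bij_witness[where i = prod.swap and j = prod.swap])
         (auto simp: add.commute mult.commute)
    then show "mcoeff (f * g) d = mcoeff (g * f) d"
      by (simp add: times_mfps_def)
  qed
  show "1 * f = f"
  proof (rule mfps_eqI)
    fix d :: "'a multiset"
    have "mcoeff (1 * f) d
        = (\<Sum>(a, b) | a + b = d. (if a = {#} then 1 else 0) * mcoeff f b)"
      by (simp add: times_mfps_def one_mfps_def)
    also have "\<dots> = (\<Sum>(a, b) \<in> {({#} :: 'a multiset, d)}. (if a = {#} then 1 else 0) * mcoeff f b)"
      by (rule sum.mono_neutral_right) (auto simp: finite_splittings split: if_splits)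
    finally show "mcoeff (1 * f) d = mcoeff f d" by simp
  qed
  show "(f + g) * h = f * h + g * h"
    by (rule mfps_eqI)
       (simp add: times_mfps_def plus_mfps_def case_prod_unfold ring_distribs sum.distrib)
  show "(0 :: 'a mfps) \<noteq> 1"
  proof
    assume "(0 :: 'a mfps) = 1"
    then have "mcoeff (0 :: 'a mfps) {#} = mcoeff 1 {#}" by simp
    then show False by (simp add: zero_mfps_def one_mfps_def)
  qed
qed (auto intro!: mfps_eqI simp: zero_mfps_def plus_mfps_def minus_mfps_def uminus_mfps_def)

end

definition mvar :: "'v \<Rightarrow> 'v mfps" where
  "mvar v = Abs_mfps (\<lambda>d. if d = {#v#} then 1 else 0)"

definition mscale :: "real \<Rightarrow> 'v mfps \<Rightarrow> 'v mfps" where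
  "mscale r f = Abs_mfps (\<lambda>d. r * mcoeff f d)"

definition mderiv :: "'v \<Rightarrow> 'v mfps \<Rightarrow> 'v mfps" where
  "mderiv v f = Abs_mfps (\<lambda>d. real (Suc (count d v)) * mcoeff f (add_mset v d))"

definition nonneg_series :: "'v mfps \<Rightarrow> bool" where
  "nonneg_series f \<longleftrightarrow> (\<forall>d. 0 \<le> mcoeff f d)"

(* Substituting A v for each variable v is meaningful when only finitely many monomials of f
   contribute to each coefficient of the result. *)
definition msubstitutable :: "'v mfps \<Rightarrow> ('v \<Rightarrow> 'w mfps) \<Rightarrow> bool" where
  "msubstitutable f A \<longleftrightarrow> (\<forall>e. finite {d. mcoeff f d * mcoeff (\<Prod>v\<in>#d. A v) e \<noteq> 0})"

definition msubst :: "'v mfps \<Rightarrow> ('v \<Rightarrow> 'w mfps) \<Rightarrow> 'w mfps" where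
  "msubst f A = Abs_mfps (\<lambda>e.
     \<Sum>d | mcoeff f d * mcoeff (\<Prod>v\<in>#d. A v) e \<noteq> 0. mcoeff f d * mcoeff (\<Prod>v\<in>#d. A v) e)"

lemma mcoeff_prod_mset_eq_0:
  assumes "\<And>v. mcoeff (A v) {#} = 0" and "size e < size d"
  shows "mcoeff (\<Prod>v\<in>#d. A v) e = 0"
  using assms(2)
proof (induction d arbitrary: e)
  case (add v d)
  have "mcoeff (A v) a * mcoeff (\<Prod>v\<in>#d. A v) b = 0" if "a + b = e" for a b
  proof (cases "a = {#}")
    case False
    then have "0 < size a" by (simp add: nonempty_has_size)
    then have "size b < size d" using add.prems that by auto
    then show ?thesis using add.IH by simp
  qed (simp add: assms(1))
  then show ?case by (auto simp: times_mfps_def intro!: sum.neutral)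
qed simp

lemma msubstitutable_zero_const:
  fixes A :: "'v::finite \<Rightarrow> 'w mfps"
  assumes "\<And>v. mcoeff (A v) {#} = 0"
  shows "msubstitutable f A"
  unfolding msubstitutable_def
proof
  fix e
  have "{d. mcoeff f d * mcoeff (\<Prod>v\<in>#d. A v) e \<noteq> 0}
      \<subseteq> (\<Union>n\<in>{..size e}. multisets_of_size UNIV n)"
    using mcoeff_prod_mset_eq_0[of A e, OF assms]
    by (auto simp: multisets_of_size_def not_less[symmetric])
  then show "finite {d. mcoeff f d * mcoeff (\<Prod>v\<in>#d. A v) e \<noteq> 0}"
    by (rule finite_subset) auto
qed

(* The ring R[[x, y_1, ..., y_k]] is 'k option mfps with k = CARD('k): None is the variable x
   and Some i is the variable y_i. *)
type_synonym 'k system = "'k \<Rightarrow> 'k option mfps"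

definition plug_y :: "'k option mfps \<Rightarrow> ('k \<Rightarrow> 'k option mfps) \<Rightarrow> 'k option mfps" where
  "plug_y f A = msubst f (case_option (mvar None) A)"

definition pluggable_y :: "'k option mfps \<Rightarrow> ('k \<Rightarrow> 'k option mfps) \<Rightarrow> bool" where
  "pluggable_y f A \<longleftrightarrow> msubstitutable f (case_option (mvar None) A)"

primrec iterate :: "'k system \<Rightarrow> nat \<Rightarrow> 'k system" where
  "iterate F 0 = (\<lambda>i. mvar (Some i))"
| "iterate F (Suc n) = (\<lambda>i. plug_y (F i) (iterate F n))"

(* f(x, 0) as a series in x, and the inclusion of R[[x]] into R[[x, y]] *)
definition at_y0 :: "'k option mfps \<Rightarrow> real fps" where
  "at_y0 f = Abs_fps (\<lambda>n. mcoeff f (replicate_mset n None))"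

definition of_x :: "real fps \<Rightarrow> 'k option mfps" where
  "of_x t = Abs_mfps (\<lambda>d. if set_mset d \<subseteq> {None} then fps_nth t (size d) else 0)"

definition zero_const :: "('k \<Rightarrow> real fps) \<Rightarrow> bool" where
  "zero_const T \<longleftrightarrow> (\<forall>i. fps_nth (T i) 0 = 0)"

definition is_solution :: "'k system \<Rightarrow> ('k \<Rightarrow> real fps) \<Rightarrow> bool" where
  "is_solution F T \<longleftrightarrow>
     (\<forall>i. pluggable_y (F i) (\<lambda>j. of_x (T j)) \<and>
          of_x (T i) = plug_y (F i) (\<lambda>j. of_x (T j)))"

(* For series without constant term the substitutability condition is automatic. *)
lemma pluggable_y_of_x:
  fixes f :: "('k::finite) option mfps"
  assumes "zero_const T"
  shows "pluggable_y f (\<lambda>j. of_x (T j))"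
  unfolding pluggable_y_def using assms
  by (intro msubstitutable_zero_const)
     (auto simp: zero_const_def of_x_def mvar_def split: option.split)

definition jacobian :: "'k system \<Rightarrow> 'k \<Rightarrow> 'k \<Rightarrow> 'k option mfps" where
  "jacobian F i j = mderiv (Some j) (F i)"

definition jacobian0 :: "('k::finite) system \<Rightarrow> real^'k^'k" where
  "jacobian0 F = (\<chi> i j. mcoeff (jacobian F i j) {#})"

definition nonneg_matrix :: "real^'n^'m \<Rightarrow> bool" where
  "nonneg_matrix M \<longleftrightarrow> (\<forall>i j. 0 \<le> M $ i $ j)"

definition elementary :: "('k::finite) system \<Rightarrow> bool" where
  "elementary F \<longleftrightarrow>
     (\<forall>i. nonneg_series (F i)) \<and> (\<forall>i. mcoeff (F i) {#} = 0) \<and> jacobian0 F = 0"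

definition H_part :: "('k::finite) system \<Rightarrow> 'k system" where
  "H_part G i = G i - of_x (at_y0 (G i)) - (\<Sum>j\<in>UNIV. mscale (jacobian0 G $ i $ j) (mvar (Some j)))"

definition G_hat :: "('k::finite) system \<Rightarrow> 'k system" where
  "G_hat G i = (\<Sum>j\<in>UNIV. mscale (matrix_inv (mat 1 - jacobian0 G) $ i $ j)
                              (of_x (at_y0 (G j)) + H_part G j))"

definition real_eigenvalue :: "real^'n^'n \<Rightarrow> real \<Rightarrow> bool" where
  "real_eigenvalue M l \<longleftrightarrow> (\<exists>v. v \<noteq> 0 \<and> M *v v = l *\<^sub>R v)"

definition Lambda :: "real^'n^'n \<Rightarrow> real" where
  "Lambda M = Max {l. real_eigenvalue M l}"

end

theory Submission
  imports Defs
begin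

text \<open>Write \<open>J\<close> for the Jacobian of \<open>G\<close> at the origin. Moving the linear part \<open>J y\<close> to the left-hand side
  and multiplying by \<open>(I - J)\<^sup>-\<^sup>1\<close> gives the elementary system. There every remaining monomial is
  \<open>x\<close> or has degree at least two, so agreement of two arguments modulo \<open>x^(n+1)\<close> improves to agreement
  of the values modulo \<open>x^(n+2)\<close>: the system is an \<open>x\<close>-adic contraction.

  For (b), \<open>I - J\<close> has a non-negative inverse iff \<open>J v \<le> v\<close> implies \<open>0 \<le> v\<close>. If the latter fails, the
  negative part \<open>u\<close> of \<open>v\<close> satisfies \<open>u \<le> J u\<close>, and Brouwer's theorem yields an eigenvalue \<open>\<ge> 1\<close>. A
  non-negative solution \<open>T\<close> gives \<open>T = J T + R\<close> with \<open>T\<close> positive and \<open>R\<close> non-negative, and \<open>R\<close> vanishes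
  on no non-empty \<open>J\<close>-closed set of indices, since the iterates of \<open>G\<close> from \<open>0\<close> would vanish there.\<close>

section \<open>Non-negative matrices\<close>

text \<open>Real eigenvalues are roots of the characteristic polynomial. Finiteness makes the
  \<open>Max\<close> in \<open>Lambda\<close> meaningful.\<close>

lemma finite_real_eigenvalues:
  fixes M :: "real^'n^'n"
  shows "finite {l. real_eigenvalue M l}"
proof -
  \<comment> \<open>The Leibniz expansion of \<open>det (mat l - M)\<close>, each entry being a
    polynomial in \<open>l\<close> of degree at most one.\<close>
  define p :: "real poly" where
    "p = (\<Sum>q | q permutes (UNIV :: 'n set).
            [:of_int (sign q):] * (\<Prod>i\<in>UNIV. [: - M $ i $ q i, if i = q i then 1 else 0 :]))"
  have poly_p: "poly p l = det (mat l - M)" for l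
    unfolding p_def det_def
    by (auto simp: poly_sum poly_prod mat_def intro!: sum.cong prod.cong)
  have mat_mult: "mat l *v v = l *\<^sub>R v" for l and v :: "real^'n"
    by (simp add: vec_eq_iff matrix_vector_mult_def mat_def if_distrib[of "\<lambda>c. c * _"] cong: if_cong)
  have root: "poly p l = 0 \<longleftrightarrow> real_eigenvalue M l" for l
  proof -
    have "poly p l = 0 \<longleftrightarrow> \<not> invertible (mat l - M)"
      by (simp add: poly_p invertible_det_nz)
    also have "\<dots> \<longleftrightarrow> (\<exists>v. v \<noteq> 0 \<and> (mat l - M) *v v = 0)"
      by (auto simp: invertible_left_inverse matrix_left_invertible_ker)
    also have "\<dots> \<longleftrightarrow> real_eigenvalue M l"
      by (auto simp: real_eigenvalue_def matrix_vector_mult_diff_rdistrib mat_mult)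
    finally show ?thesis .
  qed
  obtain B where B: "\<And>v. norm (M *v v) \<le> norm v * B" and "B > 0"
    using bounded_linear.pos_bounded[OF matrix_vector_mul_bounded_linear[of M]] by blast
  \<comment> \<open>\<open>B\<close> bounds the operator norm, so \<open>B + 1\<close> lies beyond
    the spectrum and \<open>p\<close> is not the zero polynomial.\<close>
  have "\<not> real_eigenvalue M (B + 1)"
  proof
    assume "real_eigenvalue M (B + 1)"
    then obtain v where "v \<noteq> 0" "M *v v = (B + 1) *\<^sub>R v"
      by (auto simp: real_eigenvalue_def)
    then have "(B + 1) * norm v \<le> norm v * B" using B[of v] \<open>B > 0\<close> by simp
    then show False using \<open>v \<noteq> 0\<close> by (simp add: algebra_simps)
  qed
  then have "p \<noteq> 0" using root[of "B + 1"] by auto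
  then have "finite {l. poly p l = 0}" by (rule poly_roots_finite)
  then show ?thesis by (simp add: root)
qed

lemma matrix_vector_mult_nonneg:
  assumes "nonneg_matrix M" "\<And>i. 0 \<le> v $ i"
  shows "0 \<le> (M *v v) $ i"
  using assms by (auto simp: matrix_vector_mult_def nonneg_matrix_def intro!: sum_nonneg)

lemma matrix_vector_mult_mono:
  fixes M :: "real^'n^'m"
  assumes "nonneg_matrix M" "\<And>i. u $ i \<le> v $ i"
  shows "(M *v u) $ i \<le> (M *v v) $ i"
  using assms by (auto simp: matrix_vector_mult_def nonneg_matrix_def intro!: sum_mono mult_left_mono)

lemma matrix_vector_mult_minus: "M *v (- v) = - (M *v v)"
  for M :: "real^'n^'m"
  by (simp add: vec_eq_iff matrix_vector_mult_def sum_negf)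

text \<open>Normalising \<open>M w\<close> to coordinate sum 1 maps the compact convex set of all
  probability vectors \<open>w\<close> with \<open>a w \<le> M w\<close> to itself; a Brouwer fixed point is an eigenvector.\<close>

lemma nonneg_matrix_eigenvalue_ge:
  fixes M :: "real^'n^'n"
  assumes M: "nonneg_matrix M" and "0 \<le> a"
    and u: "\<And>i. 0 \<le> u $ i" "u \<noteq> 0" "\<And>i. a * u $ i \<le> (M *v u) $ i"
  shows "\<exists>l\<ge>a. real_eigenvalue M l"
proof -
  define s :: "real^'n \<Rightarrow> real" where "s w = (\<Sum>i\<in>UNIV. w $ i)" for w
  define C where "C = {w. (\<forall>i. 0 \<le> w $ i) \<and> s w = 1 \<and> (\<forall>i. a * w $ i \<le> (M *v w) $ i)}"
  have s_scale: "s (c *\<^sub>R w) = c * s w" for c w by (simp add: s_def sum_distrib_left)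
  have s_add: "s (v + w) = s v + s w" for v w by (simp add: s_def sum.distrib)
  have cont_s: "continuous_on A s" for A unfolding s_def by (intro continuous_intros)
  have cont_M: "continuous_on A (\<lambda>w. M *v w)" for A
    by (rule linear_continuous_on) (rule matrix_vector_mul_bounded_linear)
  have s_pos: "0 < s w" if w: "\<And>i. 0 \<le> w $ i" "w \<noteq> 0" for w
  proof -
    obtain i where "w $ i \<noteq> 0" using w(2) by (auto simp: vec_eq_iff)
    with w(1)[of i] have "0 < w $ i" by linarith
    then show ?thesis unfolding s_def using w(1) by (intro sum_pos2[of _ i]) auto
  qed
  have nz: "w \<noteq> 0" if "w \<in> C" for w using that by (auto simp: C_def s_def)
  have "closed C" unfolding C_def
    by (intro closed_Collect_conj closed_Collect_all closed_Collect_le closed_Collect_eq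
          continuous_intros cont_s cont_M)
  moreover have "bounded C"
  proof (rule boundedI)
    fix w assume "w \<in> C"
    then have "(\<Sum>i\<in>UNIV. \<bar>w $ i\<bar>) = 1" by (simp add: C_def s_def)
    then show "norm w \<le> 1" using norm_le_l1_cart[of w] by simp
  qed
  ultimately have "compact C" by (simp add: compact_eq_bounded_closed)
  have "convex C"
  proof (rule convexI)
    fix v w and p q :: real
    assume *: "v \<in> C" "w \<in> C" "0 \<le> p" "0 \<le> q" "p + q = 1"
    have "a * (p * v $ i + q * w $ i) \<le> p * (M *v v) $ i + q * (M *v w) $ i" for i
      using mult_left_mono[of "a * v $ i" "(M *v v) $ i" p]
        mult_left_mono[of "a * w $ i" "(M *v w) $ i" q] * by (simp add: C_def algebra_simps)
    then show "p *\<^sub>R v + q *\<^sub>R w \<in> C"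
      using * by (simp add: C_def s_add s_scale matrix_vector_right_distrib matrix_vector_mult_scaleR)
  qed
  have "C \<noteq> {}"
  proof -
    have "inverse (s u) *\<^sub>R u \<in> C"
      using s_pos[OF u(1,2)] u by (simp add: C_def s_scale matrix_vector_mult_scaleR field_simps)
    then show ?thesis by auto
  qed
  show ?thesis
  \<comment> \<open>Normalisation divides by \<open>s (M *v w)\<close>. If \<open>M\<close> kills a
    point of \<open>C\<close>, then \<open>a \<le> 0\<close> and the eigenvalue 0 suffices.\<close>
  proof (cases "\<exists>w\<in>C. M *v w = 0")
    case True
    then obtain w where w: "w \<in> C" "M *v w = 0" by auto
    then obtain i where "w $ i \<noteq> 0" using nz by (auto simp: vec_eq_iff)
    moreover have "0 \<le> w $ i" "a * w $ i \<le> 0" using w by (auto simp: C_def)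
    ultimately have "a \<le> 0" by (auto simp: mult_le_0_iff)
    moreover have "real_eigenvalue M 0" using nz w by (auto simp: real_eigenvalue_def)
    ultimately show ?thesis by auto
  next
    case False
    have sM: "0 < s (M *v w)" if "w \<in> C" for w
      using that False by (intro s_pos matrix_vector_mult_nonneg[OF M]) (auto simp: C_def)
    define f where "f w = inverse (s (M *v w)) *\<^sub>R (M *v w)" for w
    have "continuous_on C f" unfolding f_def
      by (intro continuous_intros cont_M continuous_on_compose2[OF cont_s[of UNIV] cont_M])
        (use sM in force)+
    moreover have "f \<in> C \<rightarrow> C"
    proof
      fix w assume w: "w \<in> C"
      have "a * (M *v w) $ i \<le> (M *v (M *v w)) $ i" for i
        using matrix_vector_mult_mono[OF M, of "a *\<^sub>R w" "M *v w" i] w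
        by (simp add: C_def matrix_vector_mult_scaleR)
      moreover have "0 \<le> (M *v w) $ i" for i
        using w by (intro matrix_vector_mult_nonneg[OF M]) (auto simp: C_def)
      ultimately show "f w \<in> C" using sM[OF w]
        by (simp add: C_def f_def s_scale matrix_vector_mult_scaleR field_simps)
    qed
    ultimately obtain w where w: "w \<in> C" "f w = w"
      using brouwer \<open>compact C\<close> \<open>convex C\<close> \<open>C \<noteq> {}\<close> by metis
    \<comment> \<open>The normalising factor at the fixed point is the eigenvalue.\<close>
    have "M *v w = s (M *v w) *\<^sub>R f w" using sM[OF w(1)] by (simp add: f_def)
    then have "real_eigenvalue M (s (M *v w))"
      using w nz by (auto simp: real_eigenvalue_def)
    moreover have "a \<le> s (M *v w)"
    proof -
      have "a * s w \<le> s (M *v w)"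
        unfolding s_def sum_distrib_left using w(1) by (intro sum_mono) (auto simp: C_def)
      then show ?thesis using w(1) by (simp add: C_def)
    qed
    ultimately show ?thesis by blast
  qed
qed

text \<open>The set under \<open>Max\<close> is non-empty by the preceding eigenvalue bound, applied
  to \<open>a = 0\<close> and the all-ones vector.\<close>

lemma Lambda_less_iff:
  assumes "nonneg_matrix M"
  shows "Lambda M < a \<longleftrightarrow> (\<forall>l. real_eigenvalue M l \<longrightarrow> l < a)"
proof -
  have "\<exists>l\<ge>0. real_eigenvalue M l"
    using assms by (intro nonneg_matrix_eigenvalue_ge[of _ _ 1] matrix_vector_mult_nonneg)
      (auto simp: vec_eq_iff intro!: matrix_vector_mult_nonneg)
  then have "{l. real_eigenvalue M l} \<noteq> {}" by auto
  then show ?thesis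
    unfolding Lambda_def by (subst Max_less_iff[OF finite_real_eigenvalues]) auto
qed

text \<open>Such an \<open>A\<close> is known as a monotone matrix. This form replaces reasoning
  about the inverse by inequalities between vectors.\<close>

definition inverse_positive :: "real^'n^'n \<Rightarrow> bool" where
  "inverse_positive A \<longleftrightarrow> (\<forall>v. (\<forall>i. 0 \<le> (A *v v) $ i) \<longrightarrow> (\<forall>i. 0 \<le> v $ i))"

lemma matrix_inv_mult:
  fixes A :: "real^'n^'n"
  assumes "invertible A"
  shows "A ** matrix_inv A = mat 1" "matrix_inv A ** A = mat 1"
  using someI_ex[OF assms[unfolded invertible_def]] by (simp_all add: matrix_inv_def)

text \<open>Monotonicity at \<open>v\<close> and \<open>- v\<close> makes the kernel trivial; the
  columns of the inverse are preimages of unit vectors, hence non-negative.\<close>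

lemma inverse_positive_iff:
  fixes A :: "real^'n^'n"
  shows "inverse_positive A \<longleftrightarrow> invertible A \<and> nonneg_matrix (matrix_inv A)"
proof (intro iffI conjI)
  assume A: "inverse_positive A"
  have "v = 0" if "A *v v = 0" for v
  proof -
    have "A *v (- v) = 0" using that by (simp add: matrix_vector_mult_minus)
    then have "0 \<le> v $ i" "0 \<le> (- v) $ i" for i
      using A that unfolding inverse_positive_def by (metis order_refl zero_index)+
    then show ?thesis by (simp add: vec_eq_iff antisym)
  qed
  then show inv: "invertible A" by (auto simp: invertible_left_inverse matrix_left_invertible_ker)
  show "nonneg_matrix (matrix_inv A)" unfolding nonneg_matrix_def
  proof (intro allI)
    fix i j
    have "A *v (matrix_inv A *v axis j 1) = axis j 1"
      by (simp add: matrix_vector_mul_assoc matrix_inv_mult[OF inv])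
    then have "0 \<le> (matrix_inv A *v axis j 1) $ i"
      using A by (auto simp: inverse_positive_def axis_def)
    then show "0 \<le> matrix_inv A $ i $ j"
      by (simp add: matrix_vector_mult_basis column_def)
  qed
next
  assume A: "invertible A \<and> nonneg_matrix (matrix_inv A)"
  show "inverse_positive A" unfolding inverse_positive_def
  proof (intro allI impI)
    fix v i assume "\<forall>i. 0 \<le> (A *v v) $ i"
    then have "0 \<le> (matrix_inv A *v (A *v v)) $ i"
      using A by (auto intro: matrix_vector_mult_nonneg)
    then show "0 \<le> v $ i" using A by (simp add: matrix_vector_mul_assoc matrix_inv_mult)
  qed
qed

lemma mult_mat1_minus: "((mat 1 - J) *v v) $ i = v $ i - (J *v v) $ i"
  for J :: "real^'n^'n"
  by (simp add: matrix_vector_mult_diff_rdistrib)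

text \<open>For an eigenvalue \<open>l \<ge> 1\<close>, the entrywise absolute value
  \<open>w\<close> of an eigenvector satisfies \<open>w \<le> J *v w\<close>, so monotonicity at
  \<open>- w\<close> forces \<open>w = 0\<close>. Conversely, the negative part of a vector
  violating monotonicity yields an eigenvalue at least 1.\<close>

lemma inverse_positive_iff_eigenvalues:
  fixes J :: "real^'n^'n"
  assumes J: "nonneg_matrix J"
  shows "inverse_positive (mat 1 - J) \<longleftrightarrow> (\<forall>l. real_eigenvalue J l \<longrightarrow> l < 1)"
proof (intro iffI allI impI)
  fix l assume pos: "inverse_positive (mat 1 - J)" and "real_eigenvalue J l"
  then obtain v where v: "v \<noteq> 0" "J *v v = l *\<^sub>R v" by (auto simp: real_eigenvalue_def)
  show "l < 1"
  proof (rule ccontr)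
    assume l: "\<not> l < 1"
    define w where "w = (\<chi> i. \<bar>v $ i\<bar>)"
    have "w $ i \<le> (J *v w) $ i" for i
    proof -
      have "w $ i \<le> \<bar>l * v $ i\<bar>"
        using l mult_right_mono[of 1 l "\<bar>v $ i\<bar>"] by (simp add: w_def abs_mult)
      also have "l * v $ i = (\<Sum>j\<in>UNIV. J $ i $ j * v $ j)"
        using arg_cong[OF v(2), of "\<lambda>u. u $ i"] by (simp add: matrix_vector_mult_def)
      also have "\<bar>\<dots>\<bar> \<le> (\<Sum>j\<in>UNIV. \<bar>J $ i $ j * v $ j\<bar>)" by (rule sum_abs)
      also have "\<dots> = (J *v w) $ i"
        using J by (simp add: matrix_vector_mult_def w_def abs_mult nonneg_matrix_def)
      finally show ?thesis .
    qed
    then have "0 \<le> (- w) $ i" for i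
      using pos[unfolded inverse_positive_def, rule_format, of "- w" i]
      by (simp add: mult_mat1_minus matrix_vector_mult_minus)
    then have "v = 0" by (simp add: w_def vec_eq_iff)
    then show False using v by simp
  qed
next
  assume ev: "\<forall>l. real_eigenvalue J l \<longrightarrow> l < 1"
  show "inverse_positive (mat 1 - J)" unfolding inverse_positive_def
  proof (rule ccontr)
    assume "\<not> (\<forall>v. (\<forall>i. 0 \<le> ((mat 1 - J) *v v) $ i) \<longrightarrow> (\<forall>i. 0 \<le> v $ i))"
    then obtain v i0 where v: "\<And>i. (J *v v) $ i \<le> v $ i" and i0: "v $ i0 < 0"
      by (auto simp: mult_mat1_minus not_le)
    define u where "u = (\<chi> i. max 0 (- v $ i))"
    have u_nonneg: "0 \<le> u $ i" for i by (simp add: u_def)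
    have "u \<noteq> 0" using i0 by (auto simp: u_def vec_eq_iff max_def intro!: exI[of _ i0])
    \<comment> \<open>Where \<open>v\<close> is negative, compare \<open>J *v (- v)\<close> with
      \<open>J *v u\<close>, using \<open>- v \<le> u\<close>; elsewhere \<open>u\<close>
      vanishes.\<close>
    have "1 * u $ i \<le> (J *v u) $ i" for i
    proof (cases "v $ i < 0")
      case True
      have "(J *v (- v)) $ i \<le> (J *v u) $ i"
        by (rule matrix_vector_mult_mono[OF J]) (simp add: u_def)
      then show ?thesis using v[of i] True by (simp add: u_def matrix_vector_mult_minus)
    next
      case False
      then show ?thesis using matrix_vector_mult_nonneg[OF J u_nonneg, of i] by (simp add: u_def)
    qed
    then obtain l where "l \<ge> 1" "real_eigenvalue J l"
      using nonneg_matrix_eigenvalue_ge[OF J _ u_nonneg \<open>u \<noteq> 0\<close>, of 1] by auto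
    then show False using ev by force
  qed
qed

text \<open>A vector \<open>v\<close> with \<open>J v \<le> v\<close> and a negative entry is lifted by the smallest multiple of \<open>t\<close> that
  makes it non-negative; the zero set of the result is closed under \<open>J\<close> and \<open>r\<close> vanishes there.\<close>

lemma inverse_positiveI:
  fixes J :: "real^'n^'n"
  assumes J: "nonneg_matrix J" and t: "\<And>i. 0 < t $ i" and r: "\<And>i. 0 \<le> r $ i"
    and eq: "t = J *v t + r"
    and closed: "\<And>Z. Z \<noteq> {} \<Longrightarrow> (\<And>i. i \<in> Z \<Longrightarrow> r $ i = 0) \<Longrightarrow>
      (\<And>i j. i \<in> Z \<Longrightarrow> J $ i $ j \<noteq> 0 \<Longrightarrow> j \<in> Z) \<Longrightarrow> False"
  shows "inverse_positive (mat 1 - J)"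
  unfolding inverse_positive_def
proof (rule ccontr)
  assume "\<not> (\<forall>v. (\<forall>i. 0 \<le> ((mat 1 - J) *v v) $ i) \<longrightarrow> (\<forall>i. 0 \<le> v $ i))"
  then obtain v i0 where v: "\<And>i. (J *v v) $ i \<le> v $ i" and i0: "v $ i0 < 0"
    by (auto simp: mult_mat1_minus not_le)
  define c where "c = Max (range (\<lambda>i. - v $ i / t $ i))"
  have c_ge: "- v $ i / t $ i \<le> c" for i by (simp add: c_def)
  have "c \<in> range (\<lambda>i. - v $ i / t $ i)" unfolding c_def by (rule Max_in) auto
  then obtain i1 where i1: "c = - v $ i1 / t $ i1" by auto
  have "0 < - v $ i0 / t $ i0" using i0 t[of i0] by (simp add: divide_neg_pos)
  then have "0 < c" using c_ge[of i0] by linarith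
  define w where "w = v + c *\<^sub>R t"
  have w: "0 \<le> w $ i" for i using c_ge[of i] t[of i] by (simp add: w_def field_simps)
  \<comment> \<open>The inequality \<open>J *v v \<le> v\<close> is added to \<open>c\<close> times
    the identity \<open>t = J *v t + r\<close>.\<close>
  have Jw: "(J *v w) $ i + c * r $ i \<le> w $ i" for i
  proof -
    have "(J *v t) $ i + r $ i = t $ i" by (metis eq vector_add_component)
    then have "c * (J *v t) $ i + c * r $ i = c * t $ i" by (metis distrib_left)
    then show ?thesis using v[of i]
      by (simp add: w_def matrix_vector_right_distrib matrix_vector_mult_scaleR)
  qed
  have nonneg: "0 \<le> (J *v w) $ i" "0 \<le> c * r $ i" for i
    using matrix_vector_mult_nonneg[OF J w] r[of i] \<open>0 < c\<close> by auto
  show False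
  proof (rule closed[of "{i. w $ i = 0}"])
    \<comment> \<open>The index attaining the maximum that defines \<open>c\<close> is where
      \<open>w\<close> touches zero.\<close>
    have "w $ i1 = 0" using t[of i1] by (simp add: w_def i1 field_simps)
    then show "{i. w $ i = 0} \<noteq> {}" by auto
    show "r $ i = 0" if "i \<in> {i. w $ i = 0}" for i
    proof -
      have "c * r $ i = 0" using Jw[of i] nonneg[of i] that unfolding mem_Collect_eq by linarith
      then show ?thesis using \<open>0 < c\<close> by simp
    qed
    show "j \<in> {i. w $ i = 0}" if "i \<in> {i. w $ i = 0}" "J $ i $ j \<noteq> 0" for i j
    proof -
      have "(\<Sum>j\<in>UNIV. J $ i $ j * w $ j) = 0"
        using Jw[of i] nonneg[of i] that by (simp add: matrix_vector_mult_def)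
      then have "J $ i $ j * w $ j = 0"
        using J w by (subst (asm) sum_nonneg_eq_0_iff) (auto simp: nonneg_matrix_def)
      then show ?thesis using that by simp
    qed
  qed
qed

section \<open>Substitution of power series in \<open>x\<close>\<close>

lemma mcoeff_zero [simp]: "mcoeff 0 d = 0"
  by (simp add: zero_mfps_def)

lemma mcoeff_add [simp]: "mcoeff (f + g) d = mcoeff f d + mcoeff g d"
  by (simp add: plus_mfps_def)

lemma mcoeff_diff [simp]: "mcoeff (f - g) d = mcoeff f d - mcoeff g d"
  by (simp add: minus_mfps_def)

lemma mcoeff_mscale [simp]: "mcoeff (mscale r f) d = r * mcoeff f d"
  by (simp add: mscale_def)

lemma mcoeff_mvar: "mcoeff (mvar v) d = (if d = {#v#} then 1 else 0)"
  by (simp add: mvar_def)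

lemma mcoeff_sum [simp]: "mcoeff (sum f A) d = (\<Sum>a\<in>A. mcoeff (f a) d)"
  by (induction A rule: infinite_finite_induct) auto

lemma at_y0_nth [simp]: "fps_nth (at_y0 f) n = mcoeff f (replicate_mset n None)"
  by (simp add: at_y0_def)

lemma set_mset_subset_singleton: "set_mset d \<subseteq> {a} \<longleftrightarrow> d = replicate_mset (size d) a"
proof
  assume "set_mset d \<subseteq> {a}"
  then show "d = replicate_mset (size d) a" by (induction d) auto
next
  assume "d = replicate_mset (size d) a"
  then show "set_mset d \<subseteq> {a}" by (metis set_mset_replicate_mset_subset empty_subsetI order_refl)
qed

text \<open>Only powers of \<open>x\<close> divide a power of \<open>x\<close>, so the sum over
  splittings of the monomial collapses to the Cauchy product.\<close>

lemma at_y0_mult: "at_y0 (f * g) = at_y0 f * at_y0 g"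
proof (rule fps_ext)
  fix n
  have "(\<Sum>(a, b) | a + b = replicate_mset n None. mcoeff f a * mcoeff g b)
      = (\<Sum>i = 0..n. mcoeff f (replicate_mset i None) * mcoeff g (replicate_mset (n - i) None))"
  proof (rule sum.reindex_bij_witness[where j = "\<lambda>(a, b). size a"
        and i = "\<lambda>i. (replicate_mset i None, replicate_mset (n - i) None)"])
    fix p assume "p \<in> {(a, b). a + b = replicate_mset n (None :: 'a option)}"
    then obtain a b where p: "p = (a, b)" "a + b = replicate_mset n None" by auto
    have "set_mset (a + b) \<subseteq> {None}" unfolding p(2) by auto
    then have "set_mset a \<subseteq> {None}" "set_mset b \<subseteq> {None}" by auto
    then have ab: "a = replicate_mset (size a) None" "b = replicate_mset (size b) None"
      by (simp_all only: set_mset_subset_singleton)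
    have "size a + size b = n" using arg_cong[OF p(2), of size] by simp
    then have n: "size b = n - size a" "size a \<le> n" by auto
    show "(case p of (a, b) \<Rightarrow> size a) \<in> {0..n}" using n p by simp
    show "(replicate_mset (case p of (a, b) \<Rightarrow> size a) None,
           replicate_mset (n - (case p of (a, b) \<Rightarrow> size a)) None) = p"
      using ab n p by simp
    show "mcoeff f (replicate_mset (case p of (a, b) \<Rightarrow> size a) None) *
          mcoeff g (replicate_mset (n - (case p of (a, b) \<Rightarrow> size a)) None) =
          (case p of (a, b) \<Rightarrow> mcoeff f a * mcoeff g b)"
      using ab n p by simp
  next
    fix i assume "i \<in> {0..n}"
    then have "replicate_mset i (None :: 'a option) + replicate_mset (n - i) None = replicate_mset n None"
      by (simp add: multiset_eq_iff)
    then show "(replicate_mset i None, replicate_mset (n - i) None) \<in>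
          {(a, b). a + b = replicate_mset n (None :: 'a option)}" by simp
  qed simp
  then show "fps_nth (at_y0 (f * g)) n = fps_nth (at_y0 f * at_y0 g) n"
    by (simp add: times_mfps_def fps_mult_nth)
qed

lemma at_y0_one: "at_y0 1 = 1"
  by (rule fps_ext) (simp add: one_mfps_def)

lemma at_y0_mvar: "at_y0 (mvar None) = fps_X" "at_y0 (mvar (Some i)) = 0"
proof -
  have "replicate_mset n (None :: 'a option) = {#None#} \<longleftrightarrow> n = 1" for n
    by (metis One_nat_def replicate_mset_0 replicate_mset_Suc size_replicate_mset size_single)
  then show "at_y0 (mvar (None :: 'a option)) = fps_X"
    by (intro fps_ext) (simp add: mcoeff_mvar fps_X_nth)
  have "replicate_mset n None \<noteq> {#Some i#}" for n
    by (metis in_replicate_mset option.distinct(1) union_single_eq_member add.right_neutral)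
  then show "at_y0 (mvar (Some i)) = 0"
    by (intro fps_ext) (simp add: mcoeff_mvar)
qed

lemma at_y0_prod_mset: "at_y0 (\<Prod>v\<in>#d. A v) = (\<Prod>v\<in>#d. at_y0 (A v))"
  by (induction d) (simp_all add: at_y0_one at_y0_mult)

lemma at_y0_of_x [simp]: "at_y0 (of_x t) = t"
  by (rule fps_ext) (simp add: of_x_def)

text \<open>This recognises the image of \<open>of_x\<close>, so that identities for
  \<open>of_x\<close> can be derived from those for \<open>at_y0\<close>.\<close>

lemma of_x_at_y0:
  assumes "\<And>d. \<not> set_mset d \<subseteq> {None} \<Longrightarrow> mcoeff f d = 0"
  shows "of_x (at_y0 f) = f"
proof (rule mfps_eqI)
  fix d
  show "mcoeff (of_x (at_y0 f)) d = mcoeff f d"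
  proof (cases "set_mset d \<subseteq> {None}")
    case True
    then have "replicate_mset (size d) None = d" by (metis set_mset_subset_singleton)
    then show ?thesis using True by (simp add: of_x_def)
  next
    case False
    then show ?thesis using assms by (simp add: of_x_def)
  qed
qed

lemma of_x_mult: "of_x (s * t) = (of_x s * of_x t :: 'k option mfps)"
proof -
  have "mcoeff (of_x s * of_x t) d = 0" if "\<not> set_mset d \<subseteq> {None}" for d :: "'k option multiset"
    using that by (auto simp: times_mfps_def of_x_def intro!: sum.neutral)
  then have "of_x (at_y0 (of_x s * of_x t :: 'k option mfps)) = (of_x s * of_x t :: 'k option mfps)"
    by (rule of_x_at_y0)
  then show ?thesis by (simp add: at_y0_mult)
qed

lemma of_x_one: "of_x 1 = 1"
  by (subst at_y0_one[symmetric], rule of_x_at_y0) (auto simp: one_mfps_def)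

lemma of_x_fps_X: "of_x fps_X = mvar None"
  by (subst at_y0_mvar(1)[symmetric], rule of_x_at_y0) (auto simp: mcoeff_mvar)

lemma of_x_inject: "of_x s = of_x t \<longleftrightarrow> s = t"
  by (metis at_y0_of_x)

lemma of_x_prod_mset: "of_x (\<Prod>v\<in>#d. A v) = (\<Prod>v\<in>#d. of_x (A v))"
  by (induction d) (simp_all add: of_x_one of_x_mult)

section \<open>Evaluation at a tuple of univariate series\<close>

definition monom_val :: "('k \<Rightarrow> real fps) \<Rightarrow> 'k option multiset \<Rightarrow> real fps" where
  "monom_val T d = (\<Prod>v\<in>#d. case_option fps_X T v)"

text \<open>This is \<open>msubst\<close> carried out inside \<open>real fps\<close>, where
  divisibility by \<open>fps_X\<close> is available. The sums run over exactly those sets whose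
  finiteness \<open>evaluable\<close> demands.\<close>

definition eval_series :: "'k option mfps \<Rightarrow> ('k \<Rightarrow> real fps) \<Rightarrow> real fps" where
  "eval_series f T = Abs_fps (\<lambda>n.
     \<Sum>d | mcoeff f d * fps_nth (monom_val T d) n \<noteq> 0. mcoeff f d * fps_nth (monom_val T d) n)"

definition evaluable :: "'k option mfps \<Rightarrow> ('k \<Rightarrow> real fps) \<Rightarrow> bool" where
  "evaluable f T \<longleftrightarrow> (\<forall>n. finite {d. mcoeff f d * fps_nth (monom_val T d) n \<noteq> 0})"

lemma monom_val_empty [simp]: "monom_val T {#} = 1"
  and monom_val_add [simp]: "monom_val T (add_mset v d) = case_option fps_X T v * monom_val T d"
  by (simp_all add: monom_val_def)

lemma at_y0_monom:
  "at_y0 (\<Prod>v\<in>#d. case_option (mvar None) A v) = monom_val (\<lambda>j. at_y0 (A j)) d"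
  unfolding monom_val_def at_y0_prod_mset
  by (intro arg_cong[where f = prod_mset] image_mset_cong) (simp add: at_y0_mvar split: option.split)

text \<open>Setting \<open>y = 0\<close> in each substituted monomial gives its
  \<open>monom_val\<close>, so the two coefficient sums have the same terms and index sets.\<close>

lemma at_y0_plug_y: "at_y0 (plug_y f A) = eval_series f (\<lambda>j. at_y0 (A j))"
proof -
  have "mcoeff (\<Prod>v\<in>#d. case_option (mvar None) A v) (replicate_mset n None)
      = fps_nth (monom_val (\<lambda>j. at_y0 (A j)) d) n" for d n
    by (simp flip: at_y0_monom)
  then show ?thesis
    by (intro fps_ext) (simp add: plug_y_def msubst_def eval_series_def)
qed

lemma of_x_monom_val:
  "(\<Prod>v\<in>#d. case_option (mvar None) (\<lambda>j. of_x (T j)) v) = of_x (monom_val T d)"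
  unfolding monom_val_def of_x_prod_mset
  by (intro arg_cong[where f = prod_mset] image_mset_cong) (simp add: of_x_fps_X split: option.split)

text \<open>No \<open>y_j\<close> survives the substitution, so the result lies in the image of
  \<open>of_x\<close> and is determined by its value at \<open>y = 0\<close>.\<close>

lemma plug_y_of_x: "plug_y f (\<lambda>j. of_x (T j)) = of_x (eval_series f T)"
proof -
  have "mcoeff (plug_y f (\<lambda>j. of_x (T j))) d = 0" if "\<not> set_mset d \<subseteq> {None}" for d
    using that by (simp add: plug_y_def msubst_def of_x_monom_val) (simp add: of_x_def)
  then have "of_x (at_y0 (plug_y f (\<lambda>j. of_x (T j)))) = plug_y f (\<lambda>j. of_x (T j))"
    by (rule of_x_at_y0)
  then show ?thesis by (simp add: at_y0_plug_y)
qed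

text \<open>Coefficients of \<open>of_x\<close> at monomials containing some \<open>y_j\<close> are
  zero, so only powers of \<open>x\<close> impose a finiteness condition.\<close>

lemma pluggable_y_iff_evaluable: "pluggable_y f (\<lambda>j. of_x (T j)) \<longleftrightarrow> evaluable f T"
  for f :: "'k option mfps"
proof -
  have "finite {d. mcoeff f d * mcoeff (of_x (monom_val T d)) e \<noteq> 0}" if "evaluable f T"
    for e :: "'k option multiset"
    using that by (cases "set_mset e \<subseteq> {None}") (simp_all add: of_x_def evaluable_def)
  moreover have "finite {d. mcoeff f d * fps_nth (monom_val T d) n \<noteq> 0}"
    if "\<forall>e :: 'k option multiset. finite {d. mcoeff f d * mcoeff (of_x (monom_val T d)) e \<noteq> 0}" for n
  proof -
    have "mcoeff (of_x (monom_val T d)) (replicate_mset n (None :: 'k option))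
        = fps_nth (monom_val T d) n" for d
      by (simp add: of_x_def)
    then show ?thesis using that[rule_format, of "replicate_mset n None"] by simp
  qed
  ultimately show ?thesis
    unfolding pluggable_y_def msubstitutable_def of_x_monom_val by (auto simp: evaluable_def)
qed

text \<open>From here on, solutions are handled entirely inside \<open>real fps\<close>.\<close>

lemma is_solution_iff:
  "is_solution F T \<longleftrightarrow> (\<forall>i. evaluable (F i) T \<and> T i = eval_series (F i) T)"
  unfolding is_solution_def
  by (simp add: plug_y_of_x of_x_inject pluggable_y_iff_evaluable)

text \<open>Enlarging the index set by zero terms allows several evaluations to be compared over a
  common finite set.\<close>

lemma eval_series_nth:
  assumes "finite D" "\<And>d. d \<notin> D \<Longrightarrow> mcoeff f d * fps_nth (monom_val T d) n = 0"
  shows "fps_nth (eval_series f T) n = (\<Sum>d\<in>D. mcoeff f d * fps_nth (monom_val T d) n)"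
  unfolding eval_series_def by simp (rule sum.mono_neutral_left, use assms in auto)

text \<open>Agreement modulo \<open>x^n\<close> becomes divisibility of the difference, to which the
  ring rules for \<open>dvd\<close> apply.\<close>

lemma fps_X_power_dvd_iff: "fps_X ^ n dvd f \<longleftrightarrow> (\<forall>m<n. fps_nth f m = 0)"
  for f :: "real fps"
proof
  assume "fps_X ^ n dvd f"
  then show "\<forall>m<n. fps_nth f m = 0" by (auto elim!: dvdE simp: fps_X_power_mult_nth)
next
  assume *: "\<forall>m<n. fps_nth f m = 0"
  have "f = fps_X ^ n * fps_shift n f"
    by (rule fps_ext) (use * in \<open>simp add: fps_X_power_mult_nth\<close>)
  then show "fps_X ^ n dvd f" by (metis dvd_triv_left)
qed

lemma fps_X_dvd_iff: "fps_X dvd f \<longleftrightarrow> fps_nth f 0 = 0" for f :: "real fps"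
  using fps_X_power_dvd_iff[of 1 f] by simp

lemma fps_X_dvd_var: "zero_const T \<Longrightarrow> fps_X dvd case_option fps_X T v"
  by (simp add: fps_X_dvd_iff zero_const_def split: option.split)

lemma fps_X_power_dvd_monom_val:
  assumes "zero_const T"
  shows "fps_X ^ size d dvd monom_val T d"
  by (induction d) (simp_all add: mult_dvd_mono fps_X_dvd_var assms)

text \<open>Telescoping changes one factor at a time: the changed factor contributes
  \<open>x^(n+1)\<close> and each of the other \<open>size d - 1\<close> factors one more power of
  \<open>x\<close>.\<close>

lemma fps_X_power_dvd_monom_val_diff:
  assumes "zero_const S" "zero_const T" and dvd: "\<And>j. fps_X ^ Suc n dvd S j - T j"
  shows "fps_X ^ (n + size d) dvd monom_val S d - monom_val T d"
proof (induction d)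
  case (add v d)
  let ?s = "case_option fps_X S v" and ?t = "case_option fps_X T v"
  have "fps_X ^ Suc n dvd ?s - ?t" using dvd by (simp split: option.split)
  then have "fps_X ^ Suc n * fps_X ^ size d dvd (?s - ?t) * monom_val S d"
    by (intro mult_dvd_mono fps_X_power_dvd_monom_val assms)
  moreover have "fps_X * fps_X ^ (n + size d) dvd ?t * (monom_val S d - monom_val T d)"
    by (intro mult_dvd_mono add.IH fps_X_dvd_var assms)
  ultimately have "fps_X ^ (n + size (add_mset v d)) dvd
      (?s - ?t) * monom_val S d + ?t * (monom_val S d - monom_val T d)"
    by (intro dvd_add) (simp_all add: power_add mult.assoc)
  then show ?case by (simp add: algebra_simps)
qed simp

lemma finite_bounded_size: "finite {d :: 'v::finite multiset. size d \<le> n}"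
  proof (rule finite_subset)
  show "{d :: 'v multiset. size d \<le> n} \<subseteq> (\<Union>m\<in>{..n}. multisets_of_size UNIV m)"
    by (auto simp: multisets_of_size_def)
qed auto

text \<open>Every factor contributes a power of \<open>x\<close>, so monomials of degree above
  \<open>n\<close> do not reach \<open>x^n\<close>; the index set is finite and the same for all
  \<open>T\<close>.\<close>

lemma eval_series_nth_zero_const:
  fixes f :: "('k::finite) option mfps"
  assumes "zero_const T"
  shows "fps_nth (eval_series f T) n = (\<Sum>d | size d \<le> n. mcoeff f d * fps_nth (monom_val T d) n)"
proof (rule eval_series_nth[OF finite_bounded_size])
  fix d :: "'k option multiset" assume "d \<notin> {d. size d \<le> n}"
  then show "mcoeff f d * fps_nth (monom_val T d) n = 0"
    using fps_X_power_dvd_monom_val[OF assms, of d] by (simp add: fps_X_power_dvd_iff)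
qed

lemma evaluable_zero_const: "zero_const T \<Longrightarrow> evaluable f T"
  for f :: "('k::finite) option mfps"
  using pluggable_y_of_x pluggable_y_iff_evaluable by blast

lemma zero_const_eval_series:
  fixes F :: "('k::finite) system"
  assumes "\<forall>i. mcoeff (F i) {#} = 0" "zero_const T"
  shows "zero_const (\<lambda>i. eval_series (F i) T)"
  using assms by (simp add: zero_const_def[of "\<lambda>i. eval_series (F i) T"] eval_series_nth_zero_const)

section \<open>Linearity of evaluation\<close>

lemma eval_series_add:
  assumes "evaluable f T" "evaluable g T"
  shows "evaluable (f + g) T" "eval_series (f + g) T = eval_series f T + eval_series g T"
proof -
  define D where "D n = {d. mcoeff f d * fps_nth (monom_val T d) n \<noteq> 0} \<union>
    {d. mcoeff g d * fps_nth (monom_val T d) n \<noteq> 0}" for n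
  have D: "finite (D n)" for n using assms unfolding D_def evaluable_def by blast
  show "evaluable (f + g) T" unfolding evaluable_def
    by (rule allI, rule finite_subset[OF _ D]) (auto simp: D_def)
  show "eval_series (f + g) T = eval_series f T + eval_series g T"
  proof (rule fps_ext)
    fix n
    have "fps_nth (eval_series f T) n = (\<Sum>d\<in>D n. mcoeff f d * fps_nth (monom_val T d) n)"
      "fps_nth (eval_series g T) n = (\<Sum>d\<in>D n. mcoeff g d * fps_nth (monom_val T d) n)"
      "fps_nth (eval_series (f + g) T) n = (\<Sum>d\<in>D n. mcoeff (f + g) d * fps_nth (monom_val T d) n)"
      by (rule eval_series_nth[OF D]; auto simp: D_def)+
    then show "fps_nth (eval_series (f + g) T) n = fps_nth (eval_series f T + eval_series g T) n"
      by (simp add: distrib_right sum.distrib)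
  qed
qed

lemma eval_series_mscale:
  assumes "evaluable f T"
  shows "evaluable (mscale c f) T" "eval_series (mscale c f) T = fps_const c * eval_series f T"
proof -
  define D where "D n = {d. mcoeff f d * fps_nth (monom_val T d) n \<noteq> 0}" for n
  have D: "finite (D n)" for n using assms unfolding D_def evaluable_def by blast
  show "evaluable (mscale c f) T" unfolding evaluable_def
    by (rule allI, rule finite_subset[OF _ D]) (auto simp: D_def)
  show "eval_series (mscale c f) T = fps_const c * eval_series f T"
  proof (rule fps_ext)
    fix n
    show "fps_nth (eval_series (mscale c f) T) n = fps_nth (fps_const c * eval_series f T) n"
      using eval_series_nth[OF D, of n f T n] eval_series_nth[OF D, of n "mscale c f" T n]
      by (auto simp: D_def sum_distrib_left mult.assoc)
  qed
qed

lemma eval_series_zero: "evaluable 0 T" "eval_series 0 T = 0"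
  by (auto simp: evaluable_def eval_series_def fps_eq_iff)

lemma eval_series_mvar: "evaluable (mvar v) T" "eval_series (mvar v) T = case_option fps_X T v"
proof -
  show "evaluable (mvar v) T" unfolding evaluable_def
    by (rule allI, rule finite_subset[of _ "{{#v#}}"]) (auto simp: mcoeff_mvar)
  show "eval_series (mvar v) T = case_option fps_X T v"
    by (rule fps_ext, subst eval_series_nth[of "{{#v#}}"]) (auto simp: mcoeff_mvar)
qed

lemma eval_series_lincomb:
  assumes "\<And>a. a \<in> A \<Longrightarrow> evaluable (f a) T"
  shows "evaluable (\<Sum>a\<in>A. mscale (c a) (f a)) T"
    "eval_series (\<Sum>a\<in>A. mscale (c a) (f a)) T = (\<Sum>a\<in>A. fps_const (c a) * eval_series (f a) T)"
proof -
  have "evaluable (\<Sum>a\<in>A. mscale (c a) (f a)) T \<and>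
    eval_series (\<Sum>a\<in>A. mscale (c a) (f a)) T = (\<Sum>a\<in>A. fps_const (c a) * eval_series (f a) T)"
    using assms
    by (induction A rule: infinite_finite_induct)
      (simp_all add: eval_series_zero eval_series_add eval_series_mscale)
  then show "evaluable (\<Sum>a\<in>A. mscale (c a) (f a)) T"
    "eval_series (\<Sum>a\<in>A. mscale (c a) (f a)) T = (\<Sum>a\<in>A. fps_const (c a) * eval_series (f a) T)"
    by auto
qed

section \<open>Elementary systems\<close>

lemma jacobian0_nth: "jacobian0 F $ i $ j = mcoeff (F i) {#Some j#}"
  by (simp add: jacobian0_def jacobian_def mderiv_def)

text \<open>Monomials of degree at least two gain a power of \<open>x\<close> by telescoping. The
  monomials \<open>1\<close> and \<open>x\<close> take the same value at \<open>S\<close> and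
  \<open>T\<close>, and the monomials \<open>y_j\<close> have coefficient zero.\<close>

lemma elementary_contraction:
  fixes F :: "('k::finite) system"
  assumes F: "elementary F" and S: "zero_const S" and T: "zero_const T"
    and dvd: "\<And>j. fps_X ^ Suc n dvd S j - T j"
  shows "fps_X ^ Suc (Suc n) dvd eval_series (F i) S - eval_series (F i) T"
  unfolding fps_X_power_dvd_iff
proof (intro allI impI)
  fix m assume m: "m < Suc (Suc n)"
  have lin: "mcoeff (F i) {#Some j#} = 0" for j
    using F jacobian0_nth[of F i j] by (simp add: elementary_def)
  have "mcoeff (F i) d * fps_nth (monom_val S d) m = mcoeff (F i) d * fps_nth (monom_val T d) m" for d
  proof (cases "size d \<ge> 2")
    case True
    then show ?thesis
      using fps_X_power_dvd_monom_val_diff[OF S T dvd, of d] m by (simp add: fps_X_power_dvd_iff)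
  next
    case False
    then consider "d = {#}" | v where "d = {#v#}"
      by (metis One_nat_def less_2_cases not_le size_1_singleton_mset size_eq_0_iff_empty)
    then show ?thesis
    proof cases
      case (2 v)
      then show ?thesis using lin by (cases v) auto
    qed simp
  qed
  then have "fps_nth (eval_series (F i) S) m = fps_nth (eval_series (F i) T) m"
    unfolding eval_series_nth_zero_const[OF S] eval_series_nth_zero_const[OF T]
    by (intro sum.cong refl)
  then show "fps_nth (eval_series (F i) S - eval_series (F i) T) m = 0" by simp
qed

text \<open>At \<open>y = 0\<close> the iterates become the orbit of 0 under the evaluation map on
  tuples of univariate series.\<close>

lemma at_y0_iterate:
  "at_y0 (iterate F 0 i) = 0"
  "at_y0 (iterate F (Suc n) i) = eval_series (F i) (\<lambda>j. at_y0 (iterate F n j))"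
  by (simp_all add: at_y0_mvar at_y0_plug_y)

lemma zero_const_iterate:
  fixes F :: "('k::finite) system"
  assumes "\<forall>i. mcoeff (F i) {#} = 0"
  shows "zero_const (\<lambda>i. at_y0 (iterate F n i))"
proof (induction n)
  case 0
  show ?case unfolding at_y0_iterate by (simp add: zero_const_def)
next
  case (Suc n)
  show ?case unfolding at_y0_iterate by (rule zero_const_eval_series[OF assms Suc])
qed

lemma fps_eqI_power_dvd:
  fixes s t :: "real fps"
  assumes "\<And>n. fps_X ^ n dvd s - t"
  shows "s = t"
  using assms by (intro fps_ext) (metis fps_X_power_dvd_iff fps_sub_nth lessI right_minus_eq)

text \<open>The uniqueness half of the contraction principle: agreement modulo \<open>x\<close>
  improves by one power at each application.\<close>

lemma elementary_solution_unique:
  fixes F :: "('k::finite) system"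
  assumes F: "elementary F" and "zero_const S" "zero_const T" "is_solution F S" "is_solution F T"
  shows "S = T"
proof
  fix i
  have "fps_X ^ Suc n dvd S i - T i" for n i
  proof (induction n arbitrary: i)
    case 0
    show ?case using assms by (simp add: fps_X_dvd_iff zero_const_def)
  next
    case (Suc n)
    have "S i = eval_series (F i) S" "T i = eval_series (F i) T"
      using assms(4,5) by (auto simp: is_solution_iff)
    then show ?case
      using elementary_contraction[OF F assms(2,3) Suc, of i] by argo
  qed
  then show "S i = T i" by (intro fps_eqI_power_dvd) (metis power_le_dvd le_SucI order_refl)
qed

text \<open>The existence half of the contraction principle, with the orbit of 0 as Cauchy
  sequence.\<close>

lemma elementary_iterates_converge:
  fixes F :: "('k::finite) system"
  assumes F: "elementary F"
  obtains T where "zero_const T" "is_solution F T" "\<And>i. (\<lambda>n. at_y0 (iterate F n i)) \<longlonglongrightarrow> T i"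
proof -
  define U where "U n i = at_y0 (iterate F n i)" for n i
  have const: "\<forall>i. mcoeff (F i) {#} = 0" using F by (simp add: elementary_def)
  have U: "U 0 i = 0" "U (Suc n) i = eval_series (F i) (U n)" for n i
    unfolding U_def by (rule at_y0_iterate)+
  have zU: "zero_const (U n)" for n unfolding U_def by (rule zero_const_iterate[OF const])
  have step: "fps_X ^ Suc n dvd U (Suc n) i - U n i" for n i
  proof (induction n arbitrary: i)
    case 0
    show ?case using zU by (simp add: fps_X_dvd_iff zero_const_def)
  next
    case (Suc n)
    show ?case
      using elementary_contraction[OF F zU zU Suc, of i] by (simp only: U(2)[symmetric])
  qed
  have stable: "fps_nth (U (m + k) i) m = fps_nth (U m i) m" for m k i
  proof (induction k)
    case (Suc k)
    have "fps_nth (U (Suc (m + k)) i) m = fps_nth (U (m + k) i) m"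
      using step[of "m + k" i] unfolding fps_X_power_dvd_iff by simp
    then show ?case using Suc by simp
  qed simp
  \<comment> \<open>Coefficient \<open>m\<close> is frozen from iterate \<open>m\<close> on, so the
    diagonal is the limit.\<close>
  define T where "T i = Abs_fps (\<lambda>m. fps_nth (U m i) m)" for i
  have close: "fps_X ^ Suc n dvd T i - U n i" for n i
    unfolding fps_X_power_dvd_iff T_def using stable by (auto simp: less_Suc_eq_le le_iff_add)
  have zT: "zero_const T" using zU by (simp add: zero_const_def T_def)
  have "T i = eval_series (F i) T" for i
  \<comment> \<open>Both sides agree with the same iterate \<open>U (Suc n) i\<close> modulo
    \<open>x^(n+2)\<close>.\<close>
  proof (rule fps_eqI_power_dvd)
    fix n
    have "fps_X ^ Suc (Suc n) dvd eval_series (F i) T - U (Suc n) i"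
      unfolding U by (rule elementary_contraction[OF F zT zU close])
    moreover have "fps_X ^ Suc (Suc n) dvd T i - U (Suc n) i" by (rule close)
    ultimately have "fps_X ^ Suc (Suc n) dvd (T i - U (Suc n) i) - (eval_series (F i) T - U (Suc n) i)"
      by (rule dvd_diff[rotated])
    then show "fps_X ^ n dvd T i - eval_series (F i) T"
      by (simp del: power_Suc) (metis power_le_dvd le_SucI order_refl)
  qed
  then have "is_solution F T" by (simp add: is_solution_iff evaluable_zero_const zT)
  moreover have "(\<lambda>n. U n i) \<longlonglongrightarrow> T i" for i
  proof (rule tendsto_fpsI)
    fix m
    have "fps_nth (U n i) m = fps_nth (T i) m" if "n \<ge> m" for n
      using stable[of m "n - m" i] that by (simp add: T_def)
    then show "\<forall>\<^sub>F n in sequentially. fps_nth (U n i) m = fps_nth (T i) m"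
      by (auto simp: eventually_sequentially)
  qed
  ultimately show ?thesis using that zT unfolding U_def by blast
qed

section \<open>Eliminating the linear part\<close>

text \<open>This is \<open>G\<close> without its monomials \<open>y_j\<close>, the vector to which
  \<open>G_hat\<close> applies the inverse of \<open>mat 1 - jacobian0 G\<close>.\<close>

definition reduced_system :: "('k::finite) system \<Rightarrow> 'k system" where
  "reduced_system G i = of_x (at_y0 (G i)) + H_part G i"

lemma G_hat_reduced:
  "G_hat G i = (\<Sum>j\<in>UNIV. mscale (matrix_inv (mat 1 - jacobian0 G) $ i $ j) (reduced_system G j))"
  by (simp add: G_hat_def reduced_system_def)

lemma reduced_plus_linear:
  "G i = reduced_system G i + (\<Sum>j\<in>UNIV. mscale (jacobian0 G $ i $ j) (mvar (Some j)))"
  by (simp add: reduced_system_def H_part_def)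

lemma mcoeff_reduced:
  "mcoeff (reduced_system G i) d = (if d \<in> range (\<lambda>j. {#Some j#}) then 0 else mcoeff (G i) d)"
proof -
  have eq: "mcoeff (reduced_system G i) d =
      mcoeff (G i) d - (\<Sum>j\<in>UNIV. if d = {#Some j#} then jacobian0 G $ i $ j else 0)"
    by (subst reduced_plus_linear[of G i]) (simp add: mcoeff_mvar if_distrib cong: if_cong)
  show ?thesis
  proof (cases "d \<in> range (\<lambda>j. {#Some j#})")
    case True
    then obtain l where "d = {#Some l#}" by auto
    then show ?thesis unfolding eq by (simp add: jacobian0_nth)
  next
    case False
    then have "(\<Sum>j\<in>UNIV. if d = {#Some j#} then jacobian0 G $ i $ j else 0) = 0"
      by (intro sum.neutral) auto
    then show ?thesis unfolding eq using False by simp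
  qed
qed

lemma evaluable_reduced_iff: "evaluable (reduced_system G i) T \<longleftrightarrow> evaluable (G i) T"
proof
  assume "evaluable (reduced_system G i) T"
  then show "evaluable (G i) T"
    by (subst reduced_plus_linear) (intro eval_series_add eval_series_lincomb eval_series_mvar)
next
  assume *: "evaluable (G i) T"
  show "evaluable (reduced_system G i) T" unfolding evaluable_def
  proof
    fix n
    show "finite {d. mcoeff (reduced_system G i) d * fps_nth (monom_val T d) n \<noteq> 0}"
      by (rule finite_subset[OF _ *[unfolded evaluable_def, rule_format, of n]])
        (auto simp: mcoeff_reduced split: if_splits)
  qed
qed

lemma eval_series_reduced:
  assumes "evaluable (G i) T"
  shows "eval_series (G i) T =
    eval_series (reduced_system G i) T + (\<Sum>j\<in>UNIV. fps_const (jacobian0 G $ i $ j) * T j)"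
proof -
  have "evaluable (reduced_system G i) T" using assms by (simp add: evaluable_reduced_iff)
  then have "eval_series (reduced_system G i + (\<Sum>j\<in>UNIV. mscale (jacobian0 G $ i $ j) (mvar (Some j)))) T =
    eval_series (reduced_system G i) T + (\<Sum>j\<in>UNIV. fps_const (jacobian0 G $ i $ j) * T j)"
    by (simp add: eval_series_add eval_series_lincomb eval_series_mvar)
  then show ?thesis by (simp flip: reduced_plus_linear)
qed

text \<open>At each monomial the coefficients form a real vector, on which the matrix undoes its
  inverse.\<close>

lemma reduced_G_hat:
  assumes "invertible (mat 1 - jacobian0 G)"
  shows "reduced_system G i = (\<Sum>j\<in>UNIV. mscale ((mat 1 - jacobian0 G) $ i $ j) (G_hat G j))"
proof (rule mfps_eqI)
  fix d
  define A where "A = mat 1 - jacobian0 G"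
  define v where "v = (\<chi> j. mcoeff (reduced_system G j) d)"
  have "A *v (matrix_inv A *v v) = v"
    using assms by (simp add: A_def matrix_vector_mul_assoc matrix_inv_mult)
  then show "mcoeff (reduced_system G i) d =
      mcoeff (\<Sum>j\<in>UNIV. mscale ((mat 1 - jacobian0 G) $ i $ j) (G_hat G j)) d"
    unfolding A_def[symmetric]
    by (simp add: vec_eq_iff matrix_vector_mult_def G_hat_reduced A_def[symmetric] v_def)
qed

text \<open>\<open>G_hat G\<close> and \<open>reduced_system G\<close> are linear combinations of
  each other. Since \<open>T\<close> may have constant terms here, evaluability has to be
  transferred explicitly.\<close>

lemma evaluable_G_hat_iff:
  assumes "invertible (mat 1 - jacobian0 G)"
  shows "(\<forall>i. evaluable (G_hat G i) T) \<longleftrightarrow> (\<forall>i. evaluable (G i) T)"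
proof -
  have "(\<forall>i. evaluable (G_hat G i) T) \<longleftrightarrow> (\<forall>i. evaluable (reduced_system G i) T)"
    using eval_series_lincomb(1)[of UNIV "G_hat G" T] eval_series_lincomb(1)[of UNIV "reduced_system G" T]
      G_hat_reduced[of G] reduced_G_hat[OF assms] by (metis UNIV_I)
  then show ?thesis by (simp add: evaluable_reduced_iff)
qed

text \<open>Coefficients of \<open>x^n\<close> turn the two systems into the vector equations
  \<open>t n = N *v (g n - J *v t n)\<close> and \<open>t n = g n\<close>, which are equivalent
  because \<open>N\<close> inverts \<open>mat 1 - J\<close>.\<close>

lemma is_solution_G_hat_iff:
  fixes G :: "('k::finite) system"
  assumes inv: "invertible (mat 1 - jacobian0 G)"
  shows "is_solution (G_hat G) T \<longleftrightarrow> is_solution G T"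
proof (cases "\<forall>i. evaluable (G i) T")
  case True
  define J where "J = jacobian0 G"
  define N where "N = matrix_inv (mat 1 - J)"
  define t where "t n = (\<chi> i. fps_nth (T i) n)" for n
  define g where "g n = (\<chi> i. fps_nth (eval_series (G i) T) n)" for n
  have N: "(mat 1 - J) ** N = mat 1" "N ** (mat 1 - J) = mat 1"
    using matrix_inv_mult[OF inv] by (simp_all add: N_def J_def)
  have red: "fps_nth (eval_series (reduced_system G i) T) n = (g n - J *v t n) $ i" for i n
    using eval_series_reduced[of G i T] True
    by (simp add: g_def t_def J_def matrix_vector_mult_def fps_sum_nth)
  have "fps_nth (eval_series (G_hat G i) T) n = (N *v (g n - J *v t n)) $ i" for i n
    unfolding G_hat_reduced using True
    by (simp add: eval_series_lincomb evaluable_reduced_iff fps_sum_nth red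
        matrix_vector_mult_def N_def J_def del: vector_minus_component)
  then have "(\<forall>i. T i = eval_series (G_hat G i) T) \<longleftrightarrow> (\<forall>n. t n = N *v (g n - J *v t n))"
    by (auto simp: fps_eq_iff vec_eq_iff t_def)
  also have "\<dots> \<longleftrightarrow> (\<forall>n. t n = g n)"
  proof (intro iff_allI iffI)
    fix n assume "t n = N *v (g n - J *v t n)"
    then have "(mat 1 - J) *v t n = ((mat 1 - J) ** N) *v (g n - J *v t n)"
      by (metis matrix_vector_mul_assoc)
    then show "t n = g n" by (simp add: N matrix_vector_mult_diff_rdistrib)
  next
    fix n assume "t n = g n"
    then have "N *v (g n - J *v t n) = N *v ((mat 1 - J) *v t n)"
      by (simp add: matrix_vector_mult_diff_rdistrib)
    then show "t n = N *v (g n - J *v t n)" by (simp add: matrix_vector_mul_assoc N)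
  qed
  also have "\<dots> \<longleftrightarrow> (\<forall>i. T i = eval_series (G i) T)"
    by (auto simp: fps_eq_iff vec_eq_iff t_def g_def)
  finally show ?thesis using True evaluable_G_hat_iff[OF inv] by (auto simp: is_solution_iff)
next
  \<comment> \<open>Neither system accepts \<open>T\<close>, because a solution has to be
    evaluable.\<close>
  case False
  then show ?thesis using evaluable_G_hat_iff[OF inv, of T] by (auto simp: is_solution_iff)
qed

text \<open>\<open>reduced_system G\<close> has neither constant terms nor monomials
  \<open>y_j\<close>, and combinations with non-negative weights preserve this together with the
  signs.\<close>

lemma elementary_G_hat:
  assumes "\<forall>i. nonneg_series (G i)" "\<forall>i. mcoeff (G i) {#} = 0"
    and "nonneg_matrix (matrix_inv (mat 1 - jacobian0 G))"
  shows "elementary (G_hat G)"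
proof -
  have "0 \<le> mcoeff (reduced_system G i) d" for i d
    using assms(1) by (simp add: mcoeff_reduced nonneg_series_def)
  then have "nonneg_series (G_hat G i)" for i
    using assms(3) unfolding nonneg_series_def
    by (auto simp: G_hat_reduced nonneg_matrix_def intro!: sum_nonneg)
  moreover have "mcoeff (G_hat G i) {#} = 0" for i
    using assms(2) by (auto simp: G_hat_reduced mcoeff_reduced intro!: sum.neutral)
  moreover have "jacobian0 (G_hat G) = 0"
    by (simp add: vec_eq_iff jacobian0_nth G_hat_reduced mcoeff_reduced)
  ultimately show ?thesis by (simp add: elementary_def)
qed

section \<open>Monotone evaluation and comparison of iterates with solutions\<close>

lemma fps_mult_mono_nonneg:
  fixes s s' t t' :: "real fps"
  assumes "\<And>n. 0 \<le> fps_nth s n" "\<And>n. fps_nth s n \<le> fps_nth s' n"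
    and "\<And>n. 0 \<le> fps_nth t n" "\<And>n. fps_nth t n \<le> fps_nth t' n"
  shows "fps_nth (s * t) n \<le> fps_nth (s' * t') n"
  unfolding fps_mult_nth using assms by (intro sum_mono mult_mono) (auto intro: order_trans)

lemma monom_val_nonneg:
  assumes "\<And>i n. 0 \<le> fps_nth (T i) n"
  shows "0 \<le> fps_nth (monom_val T d) n"
proof (induction d arbitrary: n)
  case (add v d)
  then show ?case
    using assms by (auto simp: fps_mult_nth intro!: sum_nonneg mult_nonneg_nonneg split: option.split)
qed simp

lemma monom_val_mono:
  assumes "\<And>i n. 0 \<le> fps_nth (S i) n" "\<And>i n. fps_nth (S i) n \<le> fps_nth (T i) n"
  shows "fps_nth (monom_val S d) n \<le> fps_nth (monom_val T d) n"
proof (induction d arbitrary: n)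
  case (add v d)
  then show ?case unfolding monom_val_add
    using assms by (intro fps_mult_mono_nonneg monom_val_nonneg) (auto split: option.split)
qed simp

lemma eval_series_nonneg:
  fixes f :: "('k::finite) option mfps"
  assumes "nonneg_series f" "\<And>i n. 0 \<le> fps_nth (T i) n"
  shows "0 \<le> fps_nth (eval_series f T) n"
  using assms monom_val_nonneg[of T]
  by (auto simp: eval_series_def nonneg_series_def intro!: sum_nonneg)

lemma iterate_nonneg:
  fixes F :: "('k::finite) system"
  assumes "\<forall>i. nonneg_series (F i)"
  shows "0 \<le> fps_nth (at_y0 (iterate F m i)) n"
proof (induction m arbitrary: i n)
  case 0
  show ?case unfolding at_y0_iterate by simp
next
  case (Suc m)
  show ?case unfolding at_y0_iterate using assms Suc by (intro eval_series_nonneg) auto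
qed

text \<open>Evaluation is monotone on non-negative arguments, so \<open>0 \<le> T\<close> propagates
  along the orbit of 0. This transfers non-vanishing from the iterates to the solution.\<close>

lemma iterate_le_solution:
  fixes F :: "('k::finite) system"
  assumes "\<forall>i. nonneg_series (F i)" "\<forall>i. mcoeff (F i) {#} = 0"
    and T: "is_solution F T" "zero_const T" "\<And>i n. 0 \<le> fps_nth (T i) n"
  shows "fps_nth (at_y0 (iterate F m i)) n \<le> fps_nth (T i) n"
proof (induction m arbitrary: i n)
  case 0
  show ?case unfolding at_y0_iterate using T by simp
next
  case (Suc m)
  have "fps_nth (eval_series (F i) (\<lambda>j. at_y0 (iterate F m j))) n \<le> fps_nth (eval_series (F i) T) n"
    unfolding eval_series_nth_zero_const[OF T(2)]
      eval_series_nth_zero_const[OF zero_const_iterate[OF assms(2)]]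
    using assms(1) iterate_nonneg[OF assms(1)] Suc
    by (intro sum_mono mult_left_mono monom_val_mono) (auto simp: nonneg_series_def)
  moreover have "T i = eval_series (F i) T" using T(1) by (auto simp: is_solution_iff)
  ultimately show ?case unfolding at_y0_iterate by metis
qed

text \<open>Truncating and summing coefficients turns the identity \<open>T = J T + R\<close> of series into one of
  real vectors. On a \<open>J\<close>-closed set of indices where \<open>R\<close> vanishes, \<open>G\<close> is linear in the unknowns of
  that set only, so all iterates from \<open>0\<close> vanish there.\<close>

lemma nonneg_solution_imp_inverse_positive:
  fixes G :: "('k::finite) system"
  assumes G: "\<forall>i. nonneg_series (G i)" "\<forall>i. mcoeff (G i) {#} = 0"
    and nz: "\<And>i. at_y0 (iterate G N i) \<noteq> 0"
    and T: "is_solution G T" "zero_const T" "\<And>i n. 0 \<le> fps_nth (T i) n"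
  shows "inverse_positive (mat 1 - jacobian0 G)"
proof -
  \<comment> \<open>The contribution to \<open>G(x, T)\<close> of all monomials other than the
    single \<open>y_j\<close>.\<close>
  define R where "R i = eval_series (reduced_system G i) T" for i
  have J: "nonneg_matrix (jacobian0 G)"
    using G(1) by (simp add: nonneg_matrix_def jacobian0_nth nonneg_series_def)
  have red: "nonneg_series (reduced_system G i)" for i
    using G(1) by (simp add: mcoeff_reduced nonneg_series_def)
  have R: "0 \<le> fps_nth (R i) n" for i n
    unfolding R_def by (rule eval_series_nonneg[OF red T(3)])
  have T_nz: "T i \<noteq> 0" for i
  proof
    assume "T i = 0"
    then have "at_y0 (iterate G N i) = 0"
      using iterate_le_solution[OF G T, of N i] iterate_nonneg[OF G(1), of N i]
      by (intro fps_ext) (simp add: antisym)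
    then show False using nz by simp
  qed
  have TR: "fps_nth (T i) n = (\<Sum>j\<in>UNIV. jacobian0 G $ i $ j * fps_nth (T j) n) + fps_nth (R i) n"
    for i n
  proof -
    have "evaluable (G i) T" "T i = eval_series (G i) T" using T(1) by (auto simp: is_solution_iff)
    then have "T i = R i + (\<Sum>j\<in>UNIV. fps_const (jacobian0 G $ i $ j) * T j)"
      using eval_series_reduced unfolding R_def by metis
    then have "fps_nth (T i) n = fps_nth (R i + (\<Sum>j\<in>UNIV. fps_const (jacobian0 G $ i $ j) * T j)) n"
      by (rule arg_cong)
    then show ?thesis by (simp add: fps_sum_nth)
  qed
  \<comment> \<open>The sum bounds every subdegree, so truncation at \<open>M\<close> retains the
    lowest non-zero coefficient of every non-zero \<open>T i\<close> and \<open>R i\<close>.\<close>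
  define M where "M = (\<Sum>i\<in>UNIV. subdegree (T i) + subdegree (R i))"
  have sub: "subdegree (T i) \<le> M" "subdegree (R i) \<le> M" for i
    using member_le_sum[of i UNIV "\<lambda>i. subdegree (T i) + subdegree (R i)"] by (auto simp: M_def)
  show ?thesis
  proof (rule inverse_positiveI[OF J,
        where t = "\<chi> i. \<Sum>n\<le>M. fps_nth (T i) n" and r = "\<chi> i. \<Sum>n\<le>M. fps_nth (R i) n"])
    fix i
    have "fps_nth (T i) (subdegree (T i)) \<noteq> 0" using T_nz by simp
    then have "0 < fps_nth (T i) (subdegree (T i))" using T(3)[of i "subdegree (T i)"] by linarith
    then have "0 < (\<Sum>n\<le>M. fps_nth (T i) n)"
      using sub T(3) by (intro sum_pos2[of _ "subdegree (T i)"]) auto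
    then show "0 < (\<chi> i. \<Sum>n\<le>M. fps_nth (T i) n) $ i" by simp
    show "0 \<le> (\<chi> i. \<Sum>n\<le>M. fps_nth (R i) n) $ i" using R by (simp add: sum_nonneg)
  next
    have "(\<Sum>n\<le>M. fps_nth (T i) n) =
      (\<Sum>j\<in>UNIV. jacobian0 G $ i $ j * (\<Sum>n\<le>M. fps_nth (T j) n)) + (\<Sum>n\<le>M. fps_nth (R i) n)" for i
    proof -
      have "(\<Sum>n\<le>M. fps_nth (T i) n) =
          (\<Sum>n\<le>M. (\<Sum>j\<in>UNIV. jacobian0 G $ i $ j * fps_nth (T j) n) + fps_nth (R i) n)"
        by (intro sum.cong refl TR)
      also have "\<dots> = (\<Sum>n\<le>M. \<Sum>j\<in>UNIV. jacobian0 G $ i $ j * fps_nth (T j) n) + (\<Sum>n\<le>M. fps_nth (R i) n)"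
        by (rule sum.distrib)
      also have "(\<Sum>n\<le>M. \<Sum>j\<in>UNIV. jacobian0 G $ i $ j * fps_nth (T j) n) =
          (\<Sum>j\<in>UNIV. jacobian0 G $ i $ j * (\<Sum>n\<le>M. fps_nth (T j) n))"
        unfolding sum_distrib_left by (rule sum.swap)
      finally show ?thesis .
    qed
    then show "(\<chi> i. \<Sum>n\<le>M. fps_nth (T i) n) =
        jacobian0 G *v (\<chi> i. \<Sum>n\<le>M. fps_nth (T i) n) + (\<chi> i. \<Sum>n\<le>M. fps_nth (R i) n)"
      unfolding vec_eq_iff vector_add_component matrix_vector_mult_def vec_lambda_beta by blast
  next
    fix Z assume "Z \<noteq> {}" and rZ: "\<And>i. i \<in> Z \<Longrightarrow> (\<chi> i. \<Sum>n\<le>M. fps_nth (R i) n) $ i = 0"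
      and JZ: "\<And>i j. i \<in> Z \<Longrightarrow> jacobian0 G $ i $ j \<noteq> 0 \<Longrightarrow> j \<in> Z"
    have R0: "R i = 0" if "i \<in> Z" for i
    proof -
      have "\<forall>n\<in>{..M}. fps_nth (R i) n = 0"
        using rZ[OF that] R by (subst (asm) vec_lambda_beta, subst (asm) sum_nonneg_eq_0_iff) auto
      then have "fps_nth (R i) (subdegree (R i)) = 0" using sub(2)[of i] by blast
      then show ?thesis by simp
    qed
    have red0: "mcoeff (reduced_system G i) d = 0" if "i \<in> Z" for i d
    proof -
      \<comment> \<open>The monomial has a non-zero coefficient at \<open>n\<close>, since no
        \<open>T j\<close> is zero. The vanishing coefficient of \<open>R i\<close> at
        \<open>n\<close> is a sum of non-negative terms, so each term is zero.\<close>
      define n where "n = subdegree (monom_val T d)"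
      have "monom_val T d \<noteq> 0"
        using T_nz by (auto simp: monom_val_def prod_mset_zero_iff split: option.splits)
      then have n: "fps_nth (monom_val T d) n \<noteq> 0" by (simp add: n_def)
      then have "size d \<le> n"
        using fps_X_power_dvd_monom_val[OF T(2), of d] by (auto simp: fps_X_power_dvd_iff not_less[symmetric])
      have "(\<Sum>d | size d \<le> n. mcoeff (reduced_system G i) d * fps_nth (monom_val T d) n) = fps_nth (R i) n"
        unfolding R_def by (rule eval_series_nth_zero_const[OF T(2), symmetric])
      then have "(\<Sum>d | size d \<le> n. mcoeff (reduced_system G i) d * fps_nth (monom_val T d) n) = 0"
        using R0[OF that] by simp
      then have "mcoeff (reduced_system G i) d * fps_nth (monom_val T d) n = 0"
        using red[of i] monom_val_nonneg[of T, OF T(3)] \<open>size d \<le> n\<close> finite_bounded_size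
        by (subst (asm) sum_nonneg_eq_0_iff) (auto simp: nonneg_series_def)
      then show ?thesis using n by simp
    qed
    \<comment> \<open>By \<open>red0\<close>, the only monomials left in \<open>G i\<close> are
      single \<open>y_j\<close>, and \<open>JZ\<close> keeps their indices in
      \<open>Z\<close>.\<close>
    have "at_y0 (iterate G m i) = 0" if "i \<in> Z" for m i
      using that
    proof (induction m arbitrary: i)
      case 0
      show ?case by (rule at_y0_iterate)
    next
      case (Suc m)
      have "mcoeff (G i) d * fps_nth (monom_val (\<lambda>j. at_y0 (iterate G m j)) d) n = 0" for d n
      proof (cases "d \<in> range (\<lambda>j. {#Some j#})")
        case True
        then obtain l where d: "d = {#Some l#}" by auto
        then show ?thesis
          using Suc.IH[of l] JZ[OF Suc.prems, of l]
          by (cases "mcoeff (G i) {#Some l#} = 0") (simp_all add: jacobian0_nth del: at_y0_nth)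
      next
        case False
        then show ?thesis using red0[OF Suc.prems, of d] by (simp add: mcoeff_reduced)
      qed
      then show ?case unfolding at_y0_iterate eval_series_def by (simp add: fps_eq_iff)
    qed
    then show False using \<open>Z \<noteq> {}\<close> nz by blast
  qed
qed

theorem theorem4p10:
  fixes G :: "('k::finite) system"
  assumes "\<forall>i. nonneg_series (G i)"
    and "\<forall>i. mcoeff (G i) {#} = 0"
  shows
    "(invertible (mat 1 - jacobian0 G) \<and> nonneg_matrix (matrix_inv (mat 1 - jacobian0 G)) \<longrightarrow>
        (\<forall>T. is_solution (G_hat G) T \<longleftrightarrow> is_solution G T) \<and>
        elementary (G_hat G) \<and>
        (\<exists>T. (\<forall>i. (\<lambda>n. at_y0 (iterate (G_hat G) n i)) \<longlonglongrightarrow> T i) \<and>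
             zero_const T \<and> is_solution G T \<and> is_solution (G_hat G) T \<and>
             (\<forall>S. zero_const S \<and> is_solution G S \<longrightarrow> S = T) \<and>
             (\<forall>S. zero_const S \<and> is_solution (G_hat G) S \<longrightarrow> S = T)))
     \<and>
     ((\<forall>i. at_y0 (iterate G CARD('k) i) \<noteq> 0) \<longrightarrow>
        ((invertible (mat 1 - jacobian0 G) \<and> nonneg_matrix (matrix_inv (mat 1 - jacobian0 G)))
           \<longleftrightarrow> (\<exists>T. is_solution G T \<and> zero_const T \<and> (\<forall>i n. 0 \<le> fps_nth (T i) n)))
        \<and>
        ((\<exists>T. is_solution G T \<and> zero_const T \<and> (\<forall>i n. 0 \<le> fps_nth (T i) n))
           \<longleftrightarrow> Lambda (jacobian0 G) < 1))"
proof -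
  let ?inv = "invertible (mat 1 - jacobian0 G) \<and> nonneg_matrix (matrix_inv (mat 1 - jacobian0 G))"
  let ?sol = "\<exists>T. is_solution G T \<and> zero_const T \<and> (\<forall>i n. 0 \<le> fps_nth (T i) n)"
  let ?lim = "\<exists>T. (\<forall>i. (\<lambda>n. at_y0 (iterate (G_hat G) n i)) \<longlonglongrightarrow> T i) \<and>
             zero_const T \<and> is_solution G T \<and> is_solution (G_hat G) T \<and>
             (\<forall>S. zero_const S \<and> is_solution G S \<longrightarrow> S = T) \<and>
             (\<forall>S. zero_const S \<and> is_solution (G_hat G) S \<longrightarrow> S = T)"
  have J: "nonneg_matrix (jacobian0 G)"
    using assms(1) by (simp add: nonneg_matrix_def jacobian0_nth nonneg_series_def)
  have hat: "is_solution (G_hat G) T \<longleftrightarrow> is_solution G T" "elementary (G_hat G)" if ?inv for T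
    using that is_solution_G_hat_iff elementary_G_hat[OF assms] by auto
  have a: ?lim if inv: ?inv
  proof -
    obtain T where T: "zero_const T" "is_solution (G_hat G) T"
        "\<And>i. (\<lambda>n. at_y0 (iterate (G_hat G) n i)) \<longlonglongrightarrow> T i"
      using elementary_iterates_converge[OF hat(2)[OF inv]] by blast
    then have "S = T" if "zero_const S" "is_solution (G_hat G) S" for S
      using elementary_solution_unique[OF hat(2)[OF inv]] that by blast
    then show ?thesis using T hat(1)[OF inv] by metis
  qed
  have sol: ?sol if inv: ?inv
  proof -
    obtain T where lim: "\<And>i. (\<lambda>n. at_y0 (iterate (G_hat G) n i)) \<longlonglongrightarrow> T i"
      and T: "zero_const T" "is_solution G T"
      using a[OF inv] by blast
    \<comment> \<open>Each coefficient of the limit is eventually a coefficient of an iterate of the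
      non-negative system \<open>G_hat G\<close>.\<close>
    have "0 \<le> fps_nth (T i) m" for i m
    proof -
      have "\<forall>\<^sub>F n in sequentially. fps_nth (at_y0 (iterate (G_hat G) n i)) m = fps_nth (T i) m"
        using lim[of i] unfolding tendsto_fps_iff by blast
      then obtain n where "fps_nth (at_y0 (iterate (G_hat G) n i)) m = fps_nth (T i) m"
        unfolding eventually_sequentially by blast
      then show ?thesis
        using iterate_nonneg[of "G_hat G" n i m] hat(2)[OF inv] by (simp add: elementary_def)
    qed
    then show ?thesis using T by blast
  qed
  have inv: ?inv if nz: "\<forall>i. at_y0 (iterate G CARD('k) i) \<noteq> 0" and ?sol
  proof -
    obtain T where T: "is_solution G T" "zero_const T" "\<forall>i n. 0 \<le> fps_nth (T i) n"
      using \<open>?sol\<close> by blast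
    show ?thesis unfolding inverse_positive_iff[symmetric]
      by (rule nonneg_solution_imp_inverse_positive[OF assms nz[rule_format] T(1,2)]) (simp add: T(3))
  qed
  \<comment> \<open>The spectral condition matches the inverse by matrix theory alone; non-vanishing
    of the iterates enters in passing from a solution to the inverse.\<close>
  have "?inv \<longleftrightarrow> Lambda (jacobian0 G) < 1"
    using inverse_positive_iff_eigenvalues[OF J] Lambda_less_iff[OF J, of 1]
    by (simp only: inverse_positive_iff)
  with sol inv have b: "(\<forall>i. at_y0 (iterate G CARD('k) i) \<noteq> 0) \<longrightarrow>
      (?inv \<longleftrightarrow> ?sol) \<and> (?sol \<longleftrightarrow> Lambda (jacobian0 G) < 1)"
    by argo
  have "(\<forall>T. is_solution (G_hat G) T \<longleftrightarrow> is_solution G T) \<and> elementary (G_hat G) \<and> ?lim"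
    if ?inv
    using hat[OF that] a[OF that] by (intro conjI allI)
  then show ?thesis using b by (intro conjI[OF impI])
qed

end
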